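(* Let $A\subseteq\mathbb{R}$ be an open invex subset with respect to $\eta:A\times A\to\mathbb{R}$. Let $q>1$ and let $p$ satisfy $p^{-1}+q^{-1}=1$. Suppose that $f:A\to\mathbb{R}$ is a three times differentiable function and that $|f'''|^{q}$ is preinvex on $A$ with respect to $\eta$. Then for every $a,b\in A$ with $\eta(b,a)\neq 0$, $$\left|\int_{b}^{b+\eta(a,b)}f(x)\,dx-\eta(a,b)\,\frac{f(b)+f(b+\eta(a,b))}{2}-\frac{(\eta(a,b))^{2}}{12}\left[f'(b)-f'(b+\eta(a,b))\right]\right|\le\frac{(\eta(a,b))^{4}}{24\cdot 6^{\frac1q}}\left(\frac{1}{(p+1)(p+3)}\right)^{\frac1p}\left[|f'''(a)|^{q}+|f'''(b)|^{q}\right]^{\frac1q}.$$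
   Context: A set $A\subseteq\mathbb{R}$ is invex with respect to $\eta:A\times A\to\mathbb{R}$ if $u+t\,\eta(v,u)\in A$ for all $u,v\in A$ and all $t\in[0,1]$. A function $g:A\to\mathbb{R}$ on an invex set $A$ is preinvex with respect to $\eta$ if $g(u+t\,\eta(v,u))\le(1-t)g(u)+t\,g(v)$ for all $u,v\in A$ and all $t\in[0,1]$. Integrals $\int_c^d$ are oriented (the upper limit may be less than the lower limit). *)

theory Defs
  imports "HOL-Analysis.Analysis"
begin

text \<open>
  Functions defined on \<open>A\<close> (respectively on \<open>A \<times> A\<close>) are modelled as total functions whose
  values outside \<open>A\<close> play no role.
\<close>

definition invex :: "real set \<Rightarrow> (real \<Rightarrow> real \<Rightarrow> real) \<Rightarrow> bool" where
  "invex A \<eta> \<longleftrightarrow> (\<forall>u\<in>A. \<forall>v\<in>A. \<forall>t\<in>{0..1}. u + t * \<eta> v u \<in> A)"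

definition preinvex_on :: "real set \<Rightarrow> (real \<Rightarrow> real \<Rightarrow> real) \<Rightarrow> (real \<Rightarrow> real) \<Rightarrow> bool" where
  "preinvex_on A \<eta> g \<longleftrightarrow> invex A \<eta> \<and>
     (\<forall>u\<in>A. \<forall>v\<in>A. \<forall>t\<in>{0..1}. g (u + t * \<eta> v u) \<le> (1 - t) * g u + t * g v)"

text \<open>
  Intended for open \<open>A\<close>: there the iterated derivatives \<open>(deriv ^^ k) f\<close> at points of \<open>A\<close>
  depend only on the restriction of \<open>f\<close> to \<open>A\<close>.  No continuity of the last derivative is required.
\<close>

definition times_differentiable_on :: "nat \<Rightarrow> (real \<Rightarrow> real) \<Rightarrow> real set \<Rightarrow> bool" where
  "times_differentiable_on n f A \<longleftrightarrow> (\<forall>k<n. \<forall>x\<in>A. (deriv ^^ k) f differentiable (at x))"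

end

theory Submission
  imports Defs
begin

text \<open>
  Pull \<open>f\<close> back to the unit interval: \<open>F t = f (b + t h)\<close> with \<open>h = \<eta> a b\<close>. The left-hand side is
  then \<open>\<bar>h\<bar>\<close> times the error of the trapezoidal rule for \<open>F\<close> with its Euler-Maclaurin end
  correction, and three integrations by parts turn this error into an integral against a cubic
  kernel, \<open>(1/12) \<integral> t (1 - t) (2 t - 1) F''' t\<close> with \<open>F''' t = h\<^sup>3 f''' (b + t h)\<close>
  (\<open>corrected_trapezoid_Peano_kernel\<close>).

  Preinvexity bounds \<open>\<bar>f''' (b + t h)\<bar>\<close> by \<open>g t\<close>, where \<open>g\<close> is the \<open>q\<close>-th root of the affine function
  that interpolates \<open>\<bar>f''' b\<bar>\<^sup>q\<close> and \<open>\<bar>f''' a\<bar>\<^sup>q\<close>. It remains to bound \<open>\<integral> t (1 - t) \<bar>2 t - 1\<bar> g t\<close>.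
  Keeping \<open>t (1 - t)\<close> as the weight in Hoelder's inequality (\<open>weighted_Holder_inequality\<close>), rather
  than giving all of the kernel to one factor, leaves the moments
  \<open>\<integral> t (1 - t) \<bar>2 t - 1\<bar>\<^sup>p = 1 / (2 (p + 1) (p + 3))\<close> and
  \<open>\<integral> t (1 - t) (g t)\<^sup>q = (\<bar>f''' a\<bar>\<^sup>q + \<bar>f''' b\<bar>\<^sup>q) / 12\<close>. Since \<open>1/p + 1/q = 1\<close>, the powers of \<open>2\<close> in
  the two moments combine to \<open>1/2\<close>, which yields exactly the constant \<open>1 / (24 \<cdot> 6\<^sup>1\<^sup>/\<^sup>q)\<close>.

  A derivative that is not continuous may be awkward to integrate. The kernel formula is therefore
  read in the Henstock-Kurzweil sense, where the fundamental theorem of calculus integrates every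
  derivative, and \<open>f'''\<close> is replaced by the continuous function \<open>g\<close> before Hoelder's inequality is
  applied.
\<close>

section \<open>A weighted Hoelder inequality\<close>

text \<open>
  Young's inequality is applied pointwise to the two functions divided by their weighted norms, and
  integrated. The norms may vanish, so the integrals are first enlarged by \<open>e > 0\<close>, which
  finally tends to \<open>0\<close>.
\<close>

lemma weighted_Holder_inequality:
  fixes w x y :: "'a::euclidean_space \<Rightarrow> real"
  assumes p: "p > 1" and q: "q > 1" and pq: "1 / p + 1 / q = 1"
    and nonneg: "\<And>t. t \<in> S \<Longrightarrow> 0 \<le> w t" "\<And>t. t \<in> S \<Longrightarrow> 0 \<le> x t" "\<And>t. t \<in> S \<Longrightarrow> 0 \<le> y t"
    and X: "((\<lambda>t. w t * x t powr p) has_integral X) S"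
    and Y: "((\<lambda>t. w t * y t powr q) has_integral Y) S"
    and Z: "((\<lambda>t. w t * (x t * y t)) has_integral Z) S"
  shows "Z \<le> X powr (1 / p) * Y powr (1 / q)"
proof -
  have X0: "0 \<le> X"
    by (rule has_integral_nonneg[OF X]) (simp add: nonneg)
  have Y0: "0 \<le> Y"
    by (rule has_integral_nonneg[OF Y]) (simp add: nonneg)
  have bound: "Z \<le> (X + e) powr (1 / p) * (Y + e) powr (1 / q)" if e: "e > 0" for e
  proof -
    define r where "r = (X + e) powr (1 / p)"
    define s where "s = (Y + e) powr (1 / q)"
    have pos: "r > 0" "s > 0"
      using X0 Y0 e by (simp_all add: r_def s_def)
    have rp: "r powr p = X + e" and sq: "s powr q = Y + e"
      using X0 Y0 e p q by (simp_all add: r_def s_def powr_powr)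
    have young: "w t * (x t * y t)
        \<le> r * s * ((w t * x t powr p) / (p * (X + e)) + (w t * y t powr q) / (q * (Y + e)))"
      if t: "t \<in> S" for t
    proof -
      have "x t / r * (y t / s) \<le> (x t / r) powr p / p + (y t / s) powr q / q"
        by (rule Youngs_inequality[OF p q pq]) (use nonneg t pos in auto)
      also have "\<dots> = x t powr p / (p * (X + e)) + y t powr q / (q * (Y + e))"
        using pos nonneg t by (simp add: powr_divide rp sq mult.commute)
      finally have "w t * (r * s) * (x t / r * (y t / s))
          \<le> w t * (r * s) * (x t powr p / (p * (X + e)) + y t powr q / (q * (Y + e)))"
        by (rule mult_left_mono) (use pos nonneg t in auto)
      then show ?thesis
        using pos by (simp add: algebra_simps)
    qed
    have le_one: "c / (d * (c + e)) \<le> 1 / d" if "0 \<le> c" "1 < d" for c d :: real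
    proof -
      have "c / (d * (c + e)) \<le> (c + e) / (d * (c + e))"
        using that e by (intro divide_right_mono) auto
      then show ?thesis using that e by simp
    qed
    have "Z \<le> r * s * (X / (p * (X + e)) + Y / (q * (Y + e)))"
      by (rule has_integral_le[OF Z _ young])
         (intro has_integral_mult_right has_integral_add has_integral_divide X Y)
    also have "\<dots> \<le> r * s * (1 / p + 1 / q)"
      by (intro mult_left_mono add_mono) (use pos X0 Y0 p q in \<open>auto intro: le_one\<close>)
    finally show ?thesis
      by (simp add: pq r_def s_def)
  qed
  have "((\<lambda>e. (X + e) powr (1 / p) * (Y + e) powr (1 / q)) \<longlongrightarrow>
          (X + 0) powr (1 / p) * (Y + 0) powr (1 / q)) (at_right 0)"
    by (intro tendsto_intros)
       (use X0 Y0 p q in \<open>auto simp: eventually_at_right_less intro!: eventually_at_rightI[of 0 1]\<close>)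
  then have "Z \<le> (X + 0) powr (1 / p) * (Y + 0) powr (1 / q)"
    by (rule tendsto_lowerbound) (auto intro!: eventually_at_rightI[of 0 1] bound)
  then show ?thesis
    by simp
qed

section \<open>The error of the corrected trapezoidal rule\<close>

text \<open>
  With \<open>W t = t (1 - t) (2 t - 1)\<close>, integrating \<open>W F'''\<close> by parts three times produces the rule: \<open>W\<close>
  vanishes at both ends, \<open>W'\<close> equals \<open>-1\<close> at both ends (the end correction), \<open>W''\<close> takes the
  values \<open>6\<close> and \<open>-6\<close> (the trapezoidal term), and \<open>W''' = -12\<close>. Up to the factor \<open>-2\<close>, \<open>W\<close> is the
  third Bernoulli polynomial.
\<close>

lemma corrected_trapezoid_Peano_kernel:
  fixes F F1 F2 F3 :: "real \<Rightarrow> real"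
  assumes F: "\<And>t. t \<in> {0..1} \<Longrightarrow> (F has_real_derivative F1 t) (at t within {0..1})"
    and F1: "\<And>t. t \<in> {0..1} \<Longrightarrow> (F1 has_real_derivative F2 t) (at t within {0..1})"
    and F2: "\<And>t. t \<in> {0..1} \<Longrightarrow> (F2 has_real_derivative F3 t) (at t within {0..1})"
  shows "((\<lambda>t. t * (1 - t) * (2 * t - 1) * F3 t) has_integral
           12 * (integral {0..1} F - (F 0 + F 1) / 2 - (F1 0 - F1 1) / 12)) {0..1}"
proof -
  \<comment> \<open>The boundary terms \<open>W F'' - W' F' + W'' F\<close> of the three integrations by parts at once; the
    derivative telescopes to \<open>W F''' + W''' F\<close>.\<close>
  define G where "G = (\<lambda>t. t * (1 - t) * (2 * t - 1) * F2 t
                        - (- 6 * t\<^sup>2 + 6 * t - 1) * F1 t + (6 - 12 * t) * F t)"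
  have "((\<lambda>t. t * (1 - t) * (2 * t - 1) * F3 t - 12 * F t) has_integral (G 1 - G 0)) {0..1}"
  proof (rule fundamental_theorem_of_calculus)
    fix t :: real assume t: "t \<in> {0..1}"
    show "(G has_vector_derivative t * (1 - t) * (2 * t - 1) * F3 t - 12 * F t)
            (at t within {0..1})"
      unfolding has_real_derivative_iff_has_vector_derivative[symmetric] G_def
      by (auto intro!: derivative_eq_intros F[OF t] F1[OF t] F2[OF t]
               simp: algebra_simps power2_eq_square)
  qed simp
  moreover have "F integrable_on {0..1}"
    by (intro integrable_continuous_interval DERIV_continuous_on[OF F])
  then have "((\<lambda>t. 12 * F t) has_integral 12 * integral {0..1} F) {0..1}"
    by (intro has_integral_mult_right integrable_integral)
  ultimately have "((\<lambda>t. (t * (1 - t) * (2 * t - 1) * F3 t - 12 * F t) + 12 * F t) has_integral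
      (G 1 - G 0 + 12 * integral {0..1} F)) {0..1}"
    by (rule has_integral_add)
  moreover have "G 1 - G 0 + 12 * integral {0..1} F
      = 12 * (integral {0..1} F - (F 0 + F 1) / 2 - (F1 0 - F1 1) / 12)"
    by (simp add: G_def field_simps)
  ultimately show ?thesis
    by simp
qed

section \<open>The two moments of the weight\<close>

text \<open>
  In terms of \<open>u = 2 t - 1\<close> the integrand is \<open>(1 - u\<^sup>2) \<bar>u\<bar>\<^sup>p / 4\<close>. It has the odd
  antiderivative obtained by integrating \<open>\<bar>u\<bar>\<^sup>p\<close> and \<open>\<bar>u\<bar>\<^sup>p\<^sup>+\<^sup>2\<close> separately. The absolute value is not
  differentiable at \<open>u = 0\<close>, hence the exceptional point \<open>t = 1/2\<close> in the fundamental theorem.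
\<close>

lemma has_integral_weighted_abs_powr:
  fixes p :: real
  assumes p: "p > 0"
  shows "((\<lambda>t. t * (1 - t) * \<bar>2 * t - 1\<bar> powr p) has_integral 1 / (2 * ((p + 1) * (p + 3)))) {0..1}"
proof -
  define V where "V = (\<lambda>t::real. ((2 * t - 1) / (p + 1) - (2 * t - 1) ^ 3 / (p + 3))
                                    * \<bar>2 * t - 1\<bar> powr p / 8)"
  have "((\<lambda>t. t * (1 - t) * \<bar>2 * t - 1\<bar> powr p) has_integral (V 1 - V 0)) {0..1}"
  proof (rule fundamental_theorem_of_calculus_interior_strong[of "{1/2}"])
    fix t :: real assume t: "t \<in> {0<..<1} - {1 / 2}"
    define u where "u = 2 * t - 1"
    have u: "u \<noteq> 0" using t by (auto simp: u_def)
    \<comment> \<open>Writing the absolute value as a power of the square avoids a case split on the sign of \<open>u\<close>.\<close>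
    have abs_powr: "\<bar>v\<bar> powr p = (v\<^sup>2) powr (p / 2)" for v :: real
    proof -
      have "v\<^sup>2 = \<bar>v\<bar> powr 2"
        by (cases "v = 0") simp_all
      then show ?thesis by (simp only: powr_powr) simp
    qed
    have "((\<lambda>v. (v\<^sup>2) powr (p / 2)) has_real_derivative
        p / 2 * (u\<^sup>2) powr (p / 2 - 1) * (2 * u)) (at u)"
      by (rule DERIV_chain2[where f = "\<lambda>z. z powr (p / 2)", OF has_real_derivative_powr])
         (use u in \<open>auto intro!: derivative_eq_intros\<close>)
    moreover have "p / 2 * (u\<^sup>2) powr (p / 2 - 1) * (2 * u) = p * \<bar>u\<bar> powr p / u"
      using u by (simp add: powr_diff abs_powr power2_eq_square)
    ultimately have powr_deriv: "((\<lambda>v. \<bar>v\<bar> powr p) has_real_derivative p * \<bar>u\<bar> powr p / u) (at u)"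
      by (simp add: abs_powr)
    have poly_deriv: "((\<lambda>v. v / (p + 1) - v ^ 3 / (p + 3)) has_real_derivative
        1 / (p + 1) - 3 * u\<^sup>2 / (p + 3)) (at u)"
      using p by (auto intro!: derivative_eq_intros)
    have "(1 / (p + 1) - 3 * u\<^sup>2 / (p + 3)) * (m * u) + p * m * (u / (p + 1) - u ^ 3 / (p + 3))
        = ((p + 1) / (p + 1) - u\<^sup>2 * ((p + 3) / (p + 3))) * (m * u)" for m
      by (simp add: power2_eq_square power3_eq_cube algebra_simps add_divide_distrib
          del: divide_self_if)
    from this[of "\<bar>u\<bar> powr p / u"]
    have "(1 / (p + 1) - 3 * u\<^sup>2 / (p + 3)) * \<bar>u\<bar> powr p
          + p * \<bar>u\<bar> powr p / u * (u / (p + 1) - u ^ 3 / (p + 3))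
        = (1 - u\<^sup>2) * \<bar>u\<bar> powr p"
      using u p by simp
    then have D: "((\<lambda>v. (v / (p + 1) - v ^ 3 / (p + 3)) * \<bar>v\<bar> powr p / 8) has_real_derivative
        (1 - u\<^sup>2) / 8 * \<bar>u\<bar> powr p) (at u)"
      using DERIV_cdivide[OF DERIV_mult[OF poly_deriv powr_deriv], of 8] by simp
    have "((\<lambda>t. 2 * t - 1) has_real_derivative 2) (at t)"
      by (auto intro!: derivative_eq_intros)
    from DERIV_chain2[OF D[unfolded u_def] this]
    have "(V has_real_derivative (1 - u\<^sup>2) / 8 * \<bar>u\<bar> powr p * 2) (at t)"
      by (simp add: V_def u_def)
    moreover have "(1 - u\<^sup>2) / 4 = t * (1 - t)"
      by (simp add: u_def power2_eq_square field_simps)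
    then have "(1 - u\<^sup>2) / 8 * \<bar>u\<bar> powr p * 2 = t * (1 - t) * \<bar>2 * t - 1\<bar> powr p"
      by (simp add: u_def)
    ultimately show "(V has_vector_derivative t * (1 - t) * \<bar>2 * t - 1\<bar> powr p) (at t)"
      by (simp flip: has_real_derivative_iff_has_vector_derivative)
  next
    show "continuous_on {0..1} V"
      unfolding V_def using p by (intro continuous_intros continuous_on_powr') auto
  qed auto
  moreover have "V 1 - V 0 = 1 / (2 * ((p + 1) * (p + 3)))"
  proof -
    have "V 1 = (1 / (p + 1) - 1 / (p + 3)) / 8" and "V 0 = - (1 / (p + 1) - 1 / (p + 3)) / 8"
      by (simp_all add: V_def)
    moreover have "c / 8 - - c / 8 = c / 4" for c :: real
      by simp
    ultimately have "V 1 - V 0 = (1 / (p + 1) - 1 / (p + 3)) / 4"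
      by metis
    also have "1 / (p + 1) - 1 / (p + 3) = 2 / ((p + 1) * (p + 3))"
      using p by (simp add: divide_simps)
    finally show ?thesis by simp
  qed
  ultimately show ?thesis by simp
qed

lemma has_integral_weighted_affine:
  fixes A B :: real
  shows "((\<lambda>t. t * (1 - t) * ((1 - t) * B + t * A)) has_integral (A + B) / 12) {0..1}"
proof -
  define V where "V = (\<lambda>t::real. B * (t\<^sup>2 / 2 - 2 * t ^ 3 / 3 + t ^ 4 / 4) + A * (t ^ 3 / 3 - t ^ 4 / 4))"
  have "((\<lambda>t. t * (1 - t) * ((1 - t) * B + t * A)) has_integral (V 1 - V 0)) {0..1}"
    by (rule fundamental_theorem_of_calculus)
       (auto simp: V_def algebra_simps power2_eq_square power3_eq_cube
             simp flip: has_real_derivative_iff_has_vector_derivative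
             intro!: derivative_eq_intros)
  moreover have "V 1 - V 0 = (A + B) / 12"
    by (simp add: V_def field_simps)
  ultimately show ?thesis by simp
qed

section \<open>The error bound\<close>

text \<open>
  The sign of \<open>h\<close> is arbitrary: the oriented integral absorbs it, so an upper limit below the lower
  one needs no separate treatment.
\<close>

lemma interval_lebesgue_integral_eq_unit_interval:
  fixes f :: "real \<Rightarrow> real"
  assumes "continuous_on ((\<lambda>t. b + t * h) ` {0..1}) f"
  shows "(LBINT x=ereal b..ereal (b + h). f x) = h * integral {0..1} (\<lambda>t. f (b + t * h))"
proof -
  have cont: "continuous_on {0..1} (\<lambda>t. f (b + t * h))"
    by (rule continuous_on_compose2[OF assms]) (auto intro!: continuous_intros)
  have affine: "((\<lambda>t. b + t * h) has_real_derivative h) (at t within {0..1})" for t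
    by (auto intro!: derivative_eq_intros)
  have "(LBINT x=ereal b..ereal (b + h). f x) = (LBINT t=ereal 0..ereal 1. h *\<^sub>R f (b + t * h))"
    using interval_integral_substitution_finite[of 0 1 "\<lambda>t. b + t * h" "\<lambda>_. h" f, OF _ _ assms] affine
    by simp
  also have "\<dots> = integral {0..1} (\<lambda>t. h *\<^sub>R f (b + t * h))"
    by (rule interval_integral_eq_integral)
       (auto intro!: borel_integrable_atLeastAtMost' continuous_intros cont)
  finally show ?thesis by simp
qed

text \<open>
  The analytic core, free of invexity: the third derivative is dominated by \<open>C\<close> times the \<open>q\<close>-th
  root of an affine function with end values \<open>B\<close> and \<open>A\<close>. The kernel formula reduces the claim to
  the weighted Hoelder inequality with weight \<open>t (1 - t)\<close>, applied to \<open>\<bar>2 t - 1\<bar>\<close> and that root.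
\<close>

lemma corrected_trapezoid_error_bound:
  fixes F F1 F2 F3 :: "real \<Rightarrow> real"
  assumes F: "\<And>t. t \<in> {0..1} \<Longrightarrow> (F has_real_derivative F1 t) (at t within {0..1})"
    and F1: "\<And>t. t \<in> {0..1} \<Longrightarrow> (F1 has_real_derivative F2 t) (at t within {0..1})"
    and F2: "\<And>t. t \<in> {0..1} \<Longrightarrow> (F2 has_real_derivative F3 t) (at t within {0..1})"
    and p: "p > 1" and q: "q > 1" and pq: "1 / p + 1 / q = 1"
    and A: "0 \<le> A" and B: "0 \<le> B" and C: "0 \<le> C"
    and F3: "\<And>t. t \<in> {0..1} \<Longrightarrow> \<bar>F3 t\<bar> \<le> C * ((1 - t) * B + t * A) powr (1 / q)"
  shows "\<bar>integral {0..1} F - (F 0 + F 1) / 2 - (F1 0 - F1 1) / 12\<bar>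
           \<le> C / (24 * 6 powr (1 / q)) * (1 / ((p + 1) * (p + 3))) powr (1 / p)
              * (A + B) powr (1 / q)"
    (is "\<bar>?R\<bar> \<le> _")
proof -
  define g where "g = (\<lambda>t. ((1 - t) * B + t * A) powr (1 / q))"
  have affine_nonneg: "0 \<le> (1 - t) * B + t * A" if "t \<in> {0..1}" for t
    using that A B by auto
  have g_powr: "g t powr q = (1 - t) * B + t * A" if "t \<in> {0..1}" for t
    using affine_nonneg[OF that] q by (simp add: g_def powr_powr)
  have g_cont: "continuous_on {0..1} g"
    unfolding g_def using q affine_nonneg by (intro continuous_intros continuous_on_powr') auto
  define Z where "Z = integral {0..1} (\<lambda>t. t * (1 - t) * (\<bar>2 * t - 1\<bar> * g t))"
  have Z: "((\<lambda>t. t * (1 - t) * (\<bar>2 * t - 1\<bar> * g t)) has_integral Z) {0..1}"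
    unfolding Z_def
    by (intro integrable_integral integrable_continuous_interval continuous_intros g_cont)
  have "((\<lambda>t. t * (1 - t) * g t powr q) has_integral (A + B) / 12) {0..1}"
    by (rule has_integral_eq[OF _ has_integral_weighted_affine]) (simp add: g_powr)
  then have "Z \<le> (1 / (2 * ((p + 1) * (p + 3)))) powr (1 / p) * ((A + B) / 12) powr (1 / q)"
    by (intro weighted_Holder_inequality[OF p q pq _ _ _ has_integral_weighted_abs_powr _ Z])
       (use p in \<open>auto simp: g_def\<close>)
  also have "\<dots> = 1 / (2 * 6 powr (1 / q)) * (1 / ((p + 1) * (p + 3))) powr (1 / p)
                    * (A + B) powr (1 / q)"
  proof -
    have X: "(1 / (2 * ((p + 1) * (p + 3)))) powr (1 / p)
            = (1 / 2) powr (1 / p) * (1 / ((p + 1) * (p + 3))) powr (1 / p)"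
      using p by (subst powr_mult[symmetric]) auto
    have Y: "((A + B) / 12) powr (1 / q)
            = (1 / 2) powr (1 / q) * ((A + B) powr (1 / q) / 6 powr (1 / q))"
      using A B by (simp flip: powr_divide powr_mult)
    have half: "(1 / 2 :: real) powr (1 / p) * (1 / 2) powr (1 / q) = 1 / 2"
      by (simp add: pq flip: powr_add)
    have "(1 / (2 * ((p + 1) * (p + 3)))) powr (1 / p) * ((A + B) / 12) powr (1 / q)
        = ((1 / 2) powr (1 / p) * (1 / 2) powr (1 / q)) * (1 / ((p + 1) * (p + 3))) powr (1 / p)
          * ((A + B) powr (1 / q) / 6 powr (1 / q))"
      unfolding X Y by (simp only: mult_ac)
    then show ?thesis unfolding half by simp
  qed
  finally have Z_le: "Z \<le> \<dots>" .
  have kernel: "((\<lambda>t. t * (1 - t) * (2 * t - 1) * F3 t) has_integral 12 * ?R) {0..1}"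
    by (rule corrected_trapezoid_Peano_kernel) (use F F1 F2 in auto)
  have "norm (integral {0..1} (\<lambda>t. t * (1 - t) * (2 * t - 1) * F3 t))
      \<le> integral {0..1} (\<lambda>t. C * (t * (1 - t) * (\<bar>2 * t - 1\<bar> * g t)))"
  proof (rule integral_norm_bound_integral)
    show "(\<lambda>t. t * (1 - t) * (2 * t - 1) * F3 t) integrable_on {0..1}"
      using kernel by (rule has_integral_integrable)
    show "(\<lambda>t. C * (t * (1 - t) * (\<bar>2 * t - 1\<bar> * g t))) integrable_on {0..1}"
      using has_integral_mult_right[OF Z] by (rule has_integral_integrable)
    fix t :: real assume t: "t \<in> {0..1}"
    have "norm (t * (1 - t) * (2 * t - 1) * F3 t) = t * (1 - t) * \<bar>2 * t - 1\<bar> * \<bar>F3 t\<bar>"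
      using t by (simp add: abs_mult)
    also have "\<dots> \<le> t * (1 - t) * \<bar>2 * t - 1\<bar> * (C * g t)"
      unfolding g_def by (intro mult_left_mono F3 t) (use t in auto)
    finally show "norm (t * (1 - t) * (2 * t - 1) * F3 t)
        \<le> C * (t * (1 - t) * (\<bar>2 * t - 1\<bar> * g t))"
      by (simp add: mult_ac)
  qed
  then have "12 * \<bar>?R\<bar> \<le> C * Z"
    unfolding integral_unique[OF kernel] integral_unique[OF has_integral_mult_right[OF Z]]
    by (simp only: real_norm_def abs_mult abs_numeral)
  also have "\<dots> \<le> C * (1 / (2 * 6 powr (1 / q)) * (1 / ((p + 1) * (p + 3))) powr (1 / p)
                    * (A + B) powr (1 / q))"
    by (intro mult_left_mono Z_le C)
  finally show ?thesis by (simp add: field_simps)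
qed

theorem theorem2:
  fixes A :: "real set" and \<eta> :: "real \<Rightarrow> real \<Rightarrow> real"
    and f :: "real \<Rightarrow> real" and p q a b :: real
  assumes "open A" and "invex A \<eta>"
    and "q > 1" and "1 / p + 1 / q = 1"
    and "times_differentiable_on 3 f A"
    and "preinvex_on A \<eta> (\<lambda>x. \<bar>(deriv ^^ 3) f x\<bar> powr q)"
    and "a \<in> A" and "b \<in> A" and "\<eta> b a \<noteq> 0"
  shows "\<bar>(LBINT x=ereal b..ereal (b + \<eta> a b). f x)
            - \<eta> a b * ((f b + f (b + \<eta> a b)) / 2)
            - (\<eta> a b)^2 / 12 * (deriv f b - deriv f (b + \<eta> a b))\<bar>
         \<le> (\<eta> a b)^4 / (24 * 6 powr (1 / q))
            * (1 / ((p + 1) * (p + 3))) powr (1 / p)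
            * (\<bar>(deriv ^^ 3) f a\<bar> powr q + \<bar>(deriv ^^ 3) f b\<bar> powr q) powr (1 / q)"
proof -
  define h where "h = \<eta> a b"
  define D where "D = (\<lambda>k. (deriv ^^ k) f)"
  define M where "M = (\<lambda>x. \<bar>D 3 x\<bar> powr q)"
  have p: "p > 1"
  proof -
    have "1 / p = 1 - 1 / q" using assms(4) by simp
    then have "0 < 1 / p" "1 / p < 1" using \<open>q > 1\<close> by simp_all
    then show ?thesis by (simp add: field_simps split: if_splits)
  qed
  have seg: "b + t * h \<in> A" if "t \<in> {0..1}" for t
    using assms(2,7,8) that by (auto simp: invex_def h_def)
  have deriv_D: "(D k has_real_derivative D (Suc k) x) (at x)" if "k < 3" "x \<in> A" for k x
    using assms(5) that
    by (simp add: times_differentiable_on_def D_def DERIV_deriv_iff_real_differentiable)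
  have deriv_seg: "((\<lambda>t. h ^ i * D k (b + t * h)) has_real_derivative h ^ Suc i * D (Suc k) (b + t * h))
      (at t within {0..1})" if "k < 3" "t \<in> {0..1}" for i k t
  proof -
    have "((\<lambda>t. b + t * h) has_real_derivative h) (at t)"
      by (auto intro!: derivative_eq_intros)
    note DERIV_cmult[OF DERIV_chain2[OF deriv_D[OF that(1) seg[OF that(2)]] this], of "h ^ i"]
    from has_field_derivative_at_within[OF this] show ?thesis
      by (simp add: mult_ac)
  qed
  have third: "\<bar>h ^ 3 * D 3 (b + t * h)\<bar>
      \<le> \<bar>h\<bar> ^ 3 * ((1 - t) * M b + t * M a) powr (1 / q)" if "t \<in> {0..1}" for t
  proof -
    have "M (b + t * h) \<le> (1 - t) * M b + t * M a"
      using assms(6-8) that by (auto simp: preinvex_on_def M_def D_def h_def)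
    then have "M (b + t * h) powr (1 / q) \<le> ((1 - t) * M b + t * M a) powr (1 / q)"
      using \<open>q > 1\<close> by (intro powr_mono2) (auto simp: M_def)
    moreover have "M (b + t * h) powr (1 / q) = \<bar>D 3 (b + t * h)\<bar>"
      using \<open>q > 1\<close> by (simp add: M_def powr_powr)
    ultimately show ?thesis
      by (simp add: abs_mult power_abs mult_left_mono)
  qed
  have cont: "continuous_on ((\<lambda>t. b + t * h) ` {0..1}) f"
  proof (intro continuous_at_imp_continuous_on ballI)
    fix x assume "x \<in> (\<lambda>t. b + t * h) ` {0..1}"
    then have "x \<in> A" using seg by blast
    from DERIV_isCont[OF deriv_D[OF _ this, of 0]] show "isCont f x"
      by (simp add: D_def)
  qed
  \<comment> \<open>Each differentiation of \<open>f (b + t h)\<close> contributes a factor \<open>h\<close>: three of them enter the bound,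
    and the fourth comes from the substitution in the integral.\<close>
  let ?R = "integral {0..1} (\<lambda>t. D 0 (b + t * h)) - (D 0 b + D 0 (b + h)) / 2
             - (h * D 1 b - h * D 1 (b + h)) / 12"
  let ?K = "(1 / ((p + 1) * (p + 3))) powr (1 / p) * (M a + M b) powr (1 / q)"
  have "\<bar>integral {0..1} (\<lambda>t. h ^ 0 * D 0 (b + t * h))
          - (h ^ 0 * D 0 (b + 0 * h) + h ^ 0 * D 0 (b + 1 * h)) / 2
          - (h ^ 1 * D 1 (b + 0 * h) - h ^ 1 * D 1 (b + 1 * h)) / 12\<bar>
        \<le> \<bar>h\<bar> ^ 3 / (24 * 6 powr (1 / q)) * (1 / ((p + 1) * (p + 3))) powr (1 / p)
          * (M a + M b) powr (1 / q)"
  proof (rule corrected_trapezoid_error_bound)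
    fix t :: real assume t: "t \<in> {0..1}"
    show "((\<lambda>t. h ^ 0 * D 0 (b + t * h)) has_real_derivative h ^ 1 * D 1 (b + t * h))
            (at t within {0..1})"
      using deriv_seg[of 0 t 0] t by simp
    show "((\<lambda>t. h ^ 1 * D 1 (b + t * h)) has_real_derivative h ^ 2 * D 2 (b + t * h))
            (at t within {0..1})"
      using deriv_seg[of 1 t 1] t by (simp add: numeral_2_eq_2)
    show "((\<lambda>t. h ^ 2 * D 2 (b + t * h)) has_real_derivative h ^ 3 * D 3 (b + t * h))
            (at t within {0..1})"
      using deriv_seg[of 2 t 2] t by (simp add: numeral_2_eq_2 numeral_3_eq_3)
    show "\<bar>h ^ 3 * D 3 (b + t * h)\<bar> \<le> \<bar>h\<bar> ^ 3 * ((1 - t) * M b + t * M a) powr (1 / q)"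
      by (rule third[OF t])
  qed (use p assms(3,4) in \<open>simp_all add: M_def\<close>)
  then have "\<bar>?R\<bar> \<le> \<bar>h\<bar> ^ 3 / (24 * 6 powr (1 / q)) * ?K"
    by simp
  then have "\<bar>h\<bar> * \<bar>?R\<bar> \<le> \<bar>h\<bar> * (\<bar>h\<bar> ^ 3 / (24 * 6 powr (1 / q)) * ?K)"
    by (rule mult_left_mono) simp
  also have "\<dots> = \<bar>h\<bar> ^ 4 / (24 * 6 powr (1 / q)) * ?K"
    by (simp add: eval_nat_numeral)
  also have "\<bar>h\<bar> ^ 4 = h ^ 4"
    by (simp add: power_even_abs)
  also have "\<bar>h\<bar> * \<bar>?R\<bar> = \<bar>(LBINT x=ereal b..ereal (b + h). f x) - h * ((f b + f (b + h)) / 2)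
      - h\<^sup>2 / 12 * (deriv f b - deriv f (b + h))\<bar>"
    unfolding abs_mult[symmetric] interval_lebesgue_integral_eq_unit_interval[OF cont]
    by (simp add: D_def algebra_simps power2_eq_square diff_divide_distrib)
  finally show ?thesis
    by (simp add: h_def M_def D_def mult.assoc)
qed

end
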